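(* Consider the linear system $x_t = Ax_{t-1}+Bu_t$ with initial condition $x_0$, and a sequence of cost functions $L_t(x,u)=f_t^x(x)+f_t^u(u)$, such that Assumptions (i), (ii), (iii) of the context hold. Let $\alpha_u > \frac{2-\sqrt 2}{2+\sqrt 2}\, l_u$. Let the positive step sizes $\gamma_v,\gamma_x$ satisfy $$\frac{2-\sqrt 2}{2\alpha_u} < \gamma_v \le \frac{2}{l_u+\alpha_u}, \qquad \frac{2\|A\|-1}{2\|A\|\alpha_x} < \gamma_x \le \frac{2}{l_x+\alpha_x}.$$ Let $u_t,x_t$ be generated by Algorithm 1 (described in the context) in closed loop with the system. Then there exist constants $\Lambda_\theta>0$ and $\Lambda_\eta>0$ such that for each $T\in\mathbb{N}_{\ge 1}$ the regret $\mathcal{R}=\mathcal{R}(T)$ of Algorithm 1 satisfies $$\mathcal{R} \le C_\mu + \Lambda_\theta\,\Theta_T + \Lambda_\eta\, H_T,$$ where $C_\mu = \frac{l_x}{2}\sum_{t=1}^{\mu-1}\|x_t-\theta_t\|^2$, $\Theta_T=\sum_{t=1}^T\|\theta_t-\theta_{t-1}\|^2$ and $H_T=\sum_{t=1}^T\|\eta_t-\eta_{t-1}\|^2$.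
   Context: $\|\cdot\|$ is the Euclidean norm for vectors and the induced (spectral) norm for matrices. The system is $x_t = Ax_{t-1}+Bu_t$, $t\ge 1$, with $A\in\mathbb{R}^{n\times n}$, $B\in\mathbb{R}^{n\times m}$, given $x_0\in\mathbb{R}^n$. At each time $t\ge 1$ an input $u_t\in\mathbb{R}^m$ is chosen and applied, then the cost function $L_t:\mathbb{R}^n\times\mathbb{R}^m\to\mathbb{R}$ is revealed. Assumptions. (i) For every $t\ge 0$: $L_t(x,u)=f_t^x(x)+f_t^u(u)$, where $f_t^x:\mathbb{R}^n\to\mathbb{R}$ is (differentiable,) $\alpha_x$-strongly convex and $l_x$-smooth, and $f_t^u:\mathbb{R}^m\to\mathbb{R}$ is $\alpha_u$-strongly convex and $l_u$-smooth, with constants independent of $t$. Here $f$ is $\alpha$-strongly convex ($\alpha>0$) if $f(y)\ge f(x)+\langle\nabla f(x),y-x\rangle+\frac{\alpha}{2}\|y-x\|^2$ for all $x,y$, and $l$-smooth if $f(y)\le f(x)+\langle\nabla f(x),y-x\rangle+\frac{l}{2}\|y-x\|^2$ for all $x,y$. Put $\theta_t=\arg\min_x f_t^x(x)$, $\eta_t=\arg\min_u f_t^u(u)$. (ii) For all $t\ge 1$: $\theta_t=A\theta_t+B\eta_t$. (iii) $(A,B)$ is controllable with controllability index $\mu$, i.e. $\operatorname{rank} S_c=n$ with $S_c=(B\ \ AB\ \cdots\ A^{\mu-1}B)\in\mathbb{R}^{n\times \mu m}$; moreover $\|A\|<\frac{l_x+\alpha_x}{2(l_x-\alpha_x)}$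 (the right-hand side is read as $+\infty$ if $l_x=\alpha_x$). For $A=0$ the lower bound $\frac{2\|A\|-1}{2\|A\|\alpha_x}$ on $\gamma_x$ is read as $-\infty$. Algorithm 1. Let $W=\begin{pmatrix}0_{m\times(\mu-1)m}&0_{m\times m}\\ I_{(\mu-1)m}&0_{(\mu-1)m\times m}\end{pmatrix}\in\mathbb{R}^{\mu m\times\mu m}$ and $e=\begin{pmatrix}0_{m\times(\mu-1)m}&I_m\end{pmatrix}\in\mathbb{R}^{m\times\mu m}$. Given step sizes $\gamma_v,\gamma_x$ and initialization $v_0\in\mathbb{R}^m$, $x_0$, and with $g_t=0$ for $t<1$, at each time $t\ge 1$ (given $x_{t-1}$ and $L_{t-1}$) compute $$v_t=v_{t-1}-\gamma_v\nabla f_{t-1}^u(v_{t-1}),\qquad \hat V_t=(v_t^T,\dots,v_t^T)^T\in\mathbb{R}^{\mu m},$$ $$\hat x_{t+\mu-1}=A^\mu x_{t-1}+S_c\hat V_t+S_c\sum_{i=1}^{\mu-1}W^i g_{t-i},$$ $$g_t=-\gamma_x S_c^T(S_cS_c^T)^{-1}\nabla f_{t-1}^x(\hat x_{t+\mu-1}),\qquad u_t=v_t+\sum_{i=0}^{\mu-1}eW^i g_{t-i},$$ and apply $u_t$ to the system, giving $x_t=Ax_{t-1}+Bu_t$. The fictitious cost $L_0=f_0^x+f_0^u$ is fixed so that it satisfies (i) and its minimizers are $\eta_0=v_0$ and $\theta_0=\hat x_\mu$ (hence $v_1=v_0$, $g_1=0$, and $\theta_0=\hat x_\mu=A^\mu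 x_0+S_c(v_0^T,\dots,v_0^T)^T$). Regret: $\mathcal{R}=\mathcal{R}(T)=\sum_{t=1}^T\big(L_t(x_t,u_t)-L_t(x_t^*,u_t^* )\big)$, where $(x_1^*,\dots,x_T^* )$, $(u_1^*,\dots,u_T^* )$ solve $\min\sum_{t=1}^T L_t(x_t,u_t)$ over $u_1,x_1,\dots,u_T,x_T$ subject to $x_t=Ax_{t-1}+Bu_t$, $t=1,\dots,T$, with the given $x_0$. *)

theory Defs
  imports "HOL-Analysis.Analysis"
begin

definition grad :: "('a::real_inner \<Rightarrow> real) \<Rightarrow> 'a \<Rightarrow> 'a" where
  "grad f x = (THE D. GDERIV f x :> D)"

definition strongly_convex :: "real \<Rightarrow> ('a::real_inner \<Rightarrow> real) \<Rightarrow> bool" where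
  "strongly_convex \<alpha> f \<longleftrightarrow> \<alpha> > 0 \<and>
     (\<forall>x y. f y \<ge> f x + grad f x \<bullet> (y - x) + \<alpha> / 2 * (norm (y - x))\<^sup>2)"

definition l_smooth :: "real \<Rightarrow> ('a::real_inner \<Rightarrow> real) \<Rightarrow> bool" where
  "l_smooth l f \<longleftrightarrow>
     (\<forall>x y. f y \<le> f x + grad f x \<bullet> (y - x) + l / 2 * (norm (y - x))\<^sup>2)"

definition spec_norm :: "real^'a^'b \<Rightarrow> real" where
  "spec_norm M = onorm ((*v) M)"

(* The power operation M ^ k of the type class acts entrywise on this type, so the
   power with respect to the matrix product is defined separately. *)
definition mpow :: "real^'a^'a \<Rightarrow> nat \<Rightarrow> real^'a^'a" where
  "mpow M k = (((**) M) ^^ k) (mat 1)"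

(* The controllability index mu is the cardinality of a finite linearly ordered type 'k.
   The space R^(mu m) is real^('k * 'm); the coordinate (k, j) is the j-th entry of the
   block with zero-based number blk k. *)
definition blk :: "'k::{finite,linorder} \<Rightarrow> nat" where
  "blk k = card {..<k}"

(* Block k consists of the columns of A^(blk k) B, i.e. S_c = (B  A B  ...  A^(mu-1) B). *)
definition ctrb :: "real^'n^'n \<Rightarrow> real^'m^'n \<Rightarrow> real^('k::{finite,linorder} \<times> 'm)^'n" where
  "ctrb A B = (\<chi> i p. (mpow A (blk (fst p)) ** B) $ i $ snd p)"

definition shiftW :: "real^('k::{finite,linorder} \<times> 'm::finite)^('k \<times> 'm)" where
  "shiftW = (\<chi> p q. if blk (fst p) = blk (fst q) + 1 \<and> snd p = snd q then 1 else 0)"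

definition last_block :: "real^('k::{finite,linorder} \<times> 'm::finite)^'m" where
  "last_block = (\<chi> j p. if blk (fst p) = CARD('k) - 1 \<and> snd p = j then 1 else 0)"

definition stack :: "real^'m \<Rightarrow> real^('k::{finite,linorder} \<times> 'm)" where
  "stack v = (\<chi> p. v $ snd p)"

(* Closed loop of the algorithm and the system, for given initial values v 0 and x 0.
   The convention g_t = 0 for t < 1 is rendered by g 0 = 0, because the natural number
   t - i is 0 whenever i >= t. *)
definition closed_loop ::
  "real^'n^'n \<Rightarrow> real^'m^'n \<Rightarrow> real \<Rightarrow> real \<Rightarrow>
   (nat \<Rightarrow> real^'n \<Rightarrow> real) \<Rightarrow> (nat \<Rightarrow> real^'m \<Rightarrow> real) \<Rightarrow>
   (nat \<Rightarrow> real^'m) \<Rightarrow> (nat \<Rightarrow> real^'n) \<Rightarrow> (nat \<Rightarrow> real^('k::{finite,linorder} \<times> 'm)) \<Rightarrow>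
   (nat \<Rightarrow> real^'m) \<Rightarrow> (nat \<Rightarrow> real^'n) \<Rightarrow> bool" where
  "closed_loop A B \<gamma>v \<gamma>x fx fu v xhat g u x \<longleftrightarrow>
     (let \<mu> = CARD('k); S = (ctrb A B :: real^('k \<times> 'm)^'n) in
      g 0 = 0 \<and>
      (\<forall>t\<ge>1.
         v t = v (t - 1) - \<gamma>v *\<^sub>R grad (fu (t - 1)) (v (t - 1)) \<and>
         xhat (t + \<mu> - 1) =
           mpow A \<mu> *v x (t - 1) + S *v stack (v t)
           + S *v (\<Sum>i=1..\<mu>-1. mpow shiftW i *v g (t - i)) \<and>
         g t = - \<gamma>x *\<^sub>R ((transpose S ** matrix_inv (S ** transpose S))
                          *v grad (fx (t - 1)) (xhat (t + \<mu> - 1))) \<and>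
         u t = v t + (\<Sum>i=0..\<mu>-1. (last_block ** mpow shiftW i) *v g (t - i)) \<and>
         x t = A *v x (t - 1) + B *v u t))"

definition trajectory ::
  "real^'n^'n \<Rightarrow> real^'m^'n \<Rightarrow> real^'n \<Rightarrow> nat \<Rightarrow>
   (nat \<Rightarrow> real^'n) \<Rightarrow> (nat \<Rightarrow> real^'m) \<Rightarrow> bool" where
  "trajectory A B x0 T x u \<longleftrightarrow>
     x 0 = x0 \<and> (\<forall>t\<in>{1..T}. x t = A *v x (t - 1) + B *v u t)"

definition total_cost ::
  "(nat \<Rightarrow> 'x \<Rightarrow> 'u \<Rightarrow> real) \<Rightarrow> nat \<Rightarrow> (nat \<Rightarrow> 'x) \<Rightarrow> (nat \<Rightarrow> 'u) \<Rightarrow> real" where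
  "total_cost L T x u = (\<Sum>t=1..T. L t (x t) (u t))"

definition optimal_trajectory ::
  "(nat \<Rightarrow> real^'n \<Rightarrow> real^'m \<Rightarrow> real) \<Rightarrow> real^'n^'n \<Rightarrow> real^'m^'n \<Rightarrow> real^'n \<Rightarrow> nat \<Rightarrow>
   (nat \<Rightarrow> real^'n) \<Rightarrow> (nat \<Rightarrow> real^'m) \<Rightarrow> bool" where
  "optimal_trajectory L A B x0 T x u \<longleftrightarrow>
     is_arg_min (\<lambda>(x, u). total_cost L T x u) (\<lambda>(x, u). trajectory A B x0 T x u) (x, u)"

definition regret ::
  "(nat \<Rightarrow> 'x \<Rightarrow> 'u \<Rightarrow> real) \<Rightarrow> nat \<Rightarrow> (nat \<Rightarrow> 'x) \<Rightarrow> (nat \<Rightarrow> 'u) \<Rightarrow>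
   (nat \<Rightarrow> 'x) \<Rightarrow> (nat \<Rightarrow> 'u) \<Rightarrow> real" where
  "regret L T x u xs us = (\<Sum>t=1..T. L t (x t) (u t) - L t (xs t) (us t))"

end

theory Submission
  imports Defs
begin

text \<open>
  A constrained optimum is never cheaper than the unconstrained minimizers \<open>\<theta> t\<close> and \<open>\<eta> t\<close>, and a
  smooth function exceeds its minimum by at most a multiple of the squared distance to the minimizer.
  The regret is therefore at most
  \<open>\<Sum>t. lx / 2 * (norm (x t - \<theta> t))\<^sup>2 + lu / 2 * (norm (u t - \<eta> t))\<^sup>2\<close>, and it suffices to bound these
  tracking errors in the square sum by the path lengths of \<open>\<theta>\<close> and \<open>\<eta>\<close>; only the state errors
  before time \<open>\<mu>\<close>, which no input can influence fully, are kept as they are.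

  A gradient step on an \<open>\<alpha>\<close>-strongly convex function contracts the distance to the minimizer by
  \<open>1 - \<gamma> * \<alpha>\<close> (\<open>gradient_step_contraction\<close>). Hence the error \<open>v t - \<eta> t\<close> is the output of a stable
  scalar filter driven by the increments of \<open>\<eta>\<close>, and such a filter has finite gain in the square sum
  (\<open>sq_dominated_filter\<close>).

  For the state, let \<open>z t\<close> be the prediction \<open>xhat (t + \<mu>)\<close>. Applying the whole correction \<open>g (t + 1)\<close>
  moves it to \<open>p t = z t - \<gamma>x *\<^sub>R grad (fx t) (z t)\<close>, because \<open>S\<close> has the right inverse used in the
  algorithm. The block structure of \<open>S\<close> turns the passage to the next prediction into one step of the
  system with input \<open>v (t + 1)\<close>, up to a change of \<open>v\<close> (\<open>prediction_step\<close>). Since \<open>\<theta>\<close> consists of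
  steady states, \<open>norm (z t - \<theta> t)\<close> is again filtered, now with factor
  \<open>spec_norm A * (1 - \<gamma>x * \<alpha>x)\<close>, which is \<open>0\<close> for \<open>A = 0\<close> and
  otherwise smaller than \<open>1 / 2\<close> by the lower bound on \<open>\<gamma>x\<close>
  (\<open>prediction_error_dominated\<close>).

  The corrections \<open>g\<close> are bounded by the prediction errors, so all planned corrections are
  square-dominated as well. This bounds \<open>u t - \<eta> t\<close> directly. It also bounds the distance between
  \<open>x t\<close> and the prediction \<open>p (t - \<mu>)\<close> made for it, because both arise from \<open>x (t - \<mu>)\<close> by \<open>\<mu>\<close> inputs
  that differ only through planned corrections and changes of \<open>v\<close>.
\<close>

section \<open>Sequences dominated in the square sum\<close>

text \<open>The path lengths grow with the horizon \<open>T\<close>, so the bound must hold at every \<open>T\<close> with the same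
  constant. Starting the sums at \<open>0\<close> makes \<open>D 0 = 0\<close> force \<open>f 0 = 0\<close>, so that delays written with
  truncated subtraction need no case distinction at the start.\<close>

definition sq_dominated :: "(nat \<Rightarrow> real) \<Rightarrow> (nat \<Rightarrow> real) \<Rightarrow> bool" where
  "sq_dominated D f \<longleftrightarrow> (\<exists>C\<ge>0. \<forall>T. (\<Sum>t\<le>T. (f t)\<^sup>2) \<le> C * D T)"

lemma sq_dominated_mono:
  assumes "sq_dominated D f" and "\<And>t. \<bar>h t\<bar> \<le> \<bar>f t\<bar>"
  shows "sq_dominated D h"
proof -
  have le: "(\<Sum>t\<le>T. (h t)\<^sup>2) \<le> (\<Sum>t\<le>T. (f t)\<^sup>2)" for T
    using assms(2) by (intro sum_mono) (simp add: abs_le_square_iff)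
  obtain C where C: "C \<ge> 0" "\<And>T. (\<Sum>t\<le>T. (f t)\<^sup>2) \<le> C * D T"
    using assms(1) unfolding sq_dominated_def by blast
  have "\<forall>T. (\<Sum>t\<le>T. (h t)\<^sup>2) \<le> C * D T"
    by (intro allI order_trans[OF le C(2)])
  with C(1) show ?thesis unfolding sq_dominated_def by blast
qed

lemma sq_dominated_add:
  assumes "sq_dominated D f" "sq_dominated D h"
  shows "sq_dominated D (\<lambda>t. f t + h t)"
proof -
  obtain C where C: "C \<ge> 0" "\<And>T. (\<Sum>t\<le>T. (f t)\<^sup>2) \<le> C * D T"
    using assms(1) unfolding sq_dominated_def by blast
  obtain C' where C': "C' \<ge> 0" "\<And>T. (\<Sum>t\<le>T. (h t)\<^sup>2) \<le> C' * D T"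
    using assms(2) unfolding sq_dominated_def by blast
  have sq: "(a + b)\<^sup>2 \<le> 2 * a\<^sup>2 + 2 * b\<^sup>2" for a b :: real
    using sum_squares_bound[of a b] by (simp add: power2_sum)
  have "(\<Sum>t\<le>T. (f t + h t)\<^sup>2) \<le> (2 * C + 2 * C') * D T" for T
  proof -
    have "(\<Sum>t\<le>T. (f t + h t)\<^sup>2) \<le> (\<Sum>t\<le>T. 2 * (f t)\<^sup>2 + 2 * (h t)\<^sup>2)"
      by (intro sum_mono sq)
    also have "\<dots> = 2 * (\<Sum>t\<le>T. (f t)\<^sup>2) + 2 * (\<Sum>t\<le>T. (h t)\<^sup>2)"
      by (simp add: sum.distrib sum_distrib_left)
    also have "\<dots> \<le> 2 * (C * D T) + 2 * (C' * D T)"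
      using C(2)[of T] C'(2)[of T] by linarith
    finally show ?thesis by (simp add: algebra_simps)
  qed
  moreover have "2 * C + 2 * C' \<ge> 0" using C(1) C'(1) by simp
  ultimately show ?thesis unfolding sq_dominated_def by blast
qed

lemma sq_dominated_cmult:
  assumes "sq_dominated D f"
  shows "sq_dominated D (\<lambda>t. c * f t)"
proof -
  obtain C where C: "C \<ge> 0" "\<And>T. (\<Sum>t\<le>T. (f t)\<^sup>2) \<le> C * D T"
    using assms unfolding sq_dominated_def by blast
  have "(\<Sum>t\<le>T. (c * f t)\<^sup>2) \<le> (c\<^sup>2 * C) * D T" for T
  proof -
    have "(\<Sum>t\<le>T. (c * f t)\<^sup>2) = c\<^sup>2 * (\<Sum>t\<le>T. (f t)\<^sup>2)"
      by (simp add: power_mult_distrib sum_distrib_left)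
    also have "\<dots> \<le> c\<^sup>2 * (C * D T)"
      by (intro mult_left_mono C) simp
    finally show ?thesis by (simp add: mult.assoc)
  qed
  then show ?thesis using C(1) unfolding sq_dominated_def
    by (intro exI[of _ "c\<^sup>2 * C"]) simp
qed

lemma sq_dominated_sum:
  assumes "finite I" "\<And>i. i \<in> I \<Longrightarrow> sq_dominated D (f i)"
  shows "sq_dominated D (\<lambda>t. \<Sum>i\<in>I. f i t)"
  using assms
proof (induction I rule: finite_induct)
  case empty
  show ?case unfolding sq_dominated_def by (auto intro!: exI[of _ 0])
next
  case (insert i I)
  then show ?case by (simp add: sq_dominated_add)
qed

text \<open>Since \<open>D 0 = 0\<close> forces \<open>f 0 = 0\<close>, the truncated subtraction only prepends zeros.\<close>

lemma sq_dominated_delay: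
  assumes dom: "sq_dominated D f" and D0: "D 0 = 0"
  shows "sq_dominated D (\<lambda>t. f (t - k))"
proof -
  obtain C where C: "C \<ge> 0" "\<And>T. (\<Sum>t\<le>T. (f t)\<^sup>2) \<le> C * D T"
    using dom unfolding sq_dominated_def by blast
  have f0: "f 0 = 0" using C(2)[of 0] D0 by simp
  have step: "(\<Sum>t\<le>T. (h (t - 1))\<^sup>2) \<le> (\<Sum>t\<le>T. (h t)\<^sup>2)"
    if "h 0 = 0" for h :: "nat \<Rightarrow> real" and T
  proof (cases T)
    case 0
    then show ?thesis by simp
  next
    case (Suc n)
    have "(\<Sum>t\<le>Suc n. (h (t - 1))\<^sup>2) = (\<Sum>t\<le>n. (h t)\<^sup>2)"
      by (subst sum.atMost_Suc_shift) (simp add: that)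
    then show ?thesis using Suc by simp
  qed
  have le: "(\<Sum>t\<le>T. (f (t - k))\<^sup>2) \<le> (\<Sum>t\<le>T. (f t)\<^sup>2)" for T
  proof (induction k)
    case 0
    then show ?case by simp
  next
    case (Suc k)
    have "(\<Sum>t\<le>T. (f (t - Suc k))\<^sup>2) = (\<Sum>t\<le>T. (f (t - 1 - k))\<^sup>2)" by simp
    also have "\<dots> \<le> (\<Sum>t\<le>T. (f (t - k))\<^sup>2)"
      using step[of "\<lambda>t. f (t - k)" T] f0 by simp
    finally show ?case using Suc by linarith
  qed
  have "\<forall>T. (\<Sum>t\<le>T. (f (t - k))\<^sup>2) \<le> C * D T"
    by (intro allI order_trans[OF le C(2)])
  with C(1) show ?thesis unfolding sq_dominated_def by blast
qed

text \<open>A stable scalar filter has finite gain. By convexity of the square,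
  \<open>(\<rho> * a + c)\<^sup>2 \<le> \<rho> * a\<^sup>2 + c\<^sup>2 / (1 - \<rho>)\<close>; summed over time, the first term gives back at most
  the fraction \<open>\<rho>\<close> of the square sum of \<open>f\<close>, which can be absorbed.\<close>

lemma sq_dominated_filter:
  fixes f b :: "nat \<Rightarrow> real"
  assumes dom: "sq_dominated D b" and \<rho>: "0 \<le> \<rho>" "\<rho> < 1"
    and nonneg: "\<And>t. 0 \<le> f t" and f0: "f 0 = 0"
    and step: "\<And>t. f (Suc t) \<le> \<rho> * f t + b (Suc t)"
  shows "sq_dominated D f"
proof -
  obtain C where C: "C \<ge> 0" "\<And>T. (\<Sum>t\<le>T. (b t)\<^sup>2) \<le> C * D T"
    using dom unfolding sq_dominated_def by blast
  have convex: "(\<rho> * a + c)\<^sup>2 \<le> \<rho> * a\<^sup>2 + c\<^sup>2 / (1 - \<rho>)" for a c :: real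
  proof -
    have "\<rho> * a\<^sup>2 + c\<^sup>2 / (1 - \<rho>) - (\<rho> * a + c)\<^sup>2 = \<rho> / (1 - \<rho>) * ((1 - \<rho>) * a - c)\<^sup>2"
      using \<rho> by (simp add: field_simps power2_eq_square)
    moreover have "\<dots> \<ge> 0" using \<rho> by simp
    ultimately show ?thesis by linarith
  qed
  \<comment> \<open>The extra term \<open>\<rho> * (f T)\<^sup>2\<close> is the part not yet passed on to time \<open>T + 1\<close>.\<close>
  have sum_bound: "(1 - \<rho>) * (\<Sum>t\<le>T. (f t)\<^sup>2) + \<rho> * (f T)\<^sup>2 \<le> (\<Sum>t\<le>T. (b t)\<^sup>2) / (1 - \<rho>)" for T
  proof (induction T)
    case 0
    then show ?case using \<rho> f0 by simp
  next
    case (Suc T)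
    have "(f (Suc T))\<^sup>2 \<le> (\<rho> * f T + b (Suc T))\<^sup>2"
      using step[of T] nonneg[of "Suc T"] by (intro power_mono)
    also have "\<dots> \<le> \<rho> * (f T)\<^sup>2 + (b (Suc T))\<^sup>2 / (1 - \<rho>)" by (rule convex)
    finally show ?case using Suc by (simp add: algebra_simps add_divide_distrib)
  qed
  have "(\<Sum>t\<le>T. (f t)\<^sup>2) \<le> (C / (1 - \<rho>)\<^sup>2) * D T" for T
  proof -
    have "0 \<le> \<rho> * (f T)\<^sup>2" using \<rho> by simp
    with sum_bound[of T] have "(1 - \<rho>) * (\<Sum>t\<le>T. (f t)\<^sup>2) \<le> (\<Sum>t\<le>T. (b t)\<^sup>2) / (1 - \<rho>)"
      by linarith
    also have "\<dots> \<le> C * D T / (1 - \<rho>)"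
      using C(2)[of T] \<rho> by (intro divide_right_mono) auto
    finally have "(\<Sum>t\<le>T. (f t)\<^sup>2) \<le> C * D T / (1 - \<rho>) / (1 - \<rho>)"
      using \<rho> by (simp add: pos_le_divide_eq mult.commute)
    then show ?thesis by (simp add: power2_eq_square)
  qed
  then show ?thesis using C(1) unfolding sq_dominated_def
    by (intro exI[of _ "C / (1 - \<rho>)\<^sup>2"]) simp
qed

text \<open>Differences over a lag of \<open>k\<close> telescope into \<open>k\<close> delayed one-step variations.\<close>

lemma sq_dominated_lag:
  fixes \<theta> :: "nat \<Rightarrow> 'a::real_normed_vector"
  assumes dom: "sq_dominated D (\<lambda>t. norm (\<theta> t - \<theta> (t - 1)))" and D0: "D 0 = 0"
  shows "sq_dominated D (\<lambda>t. norm (\<theta> t - \<theta> (t - k)))"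
proof -
  have "norm (\<theta> t - \<theta> (t - k)) \<le> (\<Sum>i<k. norm (\<theta> (t - i) - \<theta> (t - i - 1)))" for t
  proof (induction k)
    case 0
    then show ?case by simp
  next
    case (Suc k)
    have "norm (\<theta> t - \<theta> (t - Suc k))
        \<le> norm (\<theta> t - \<theta> (t - k)) + norm (\<theta> (t - k) - \<theta> (t - k - 1))"
      using norm_triangle_ineq[of "\<theta> t - \<theta> (t - k)" "\<theta> (t - k) - \<theta> (t - k - 1)"] by simp
    with Suc show ?case by simp
  qed
  moreover have "sq_dominated D (\<lambda>t. \<Sum>i<k. norm (\<theta> (t - i) - \<theta> (t - i - 1)))"
    by (intro sq_dominated_sum sq_dominated_delay[OF dom D0]) simp
  ultimately show ?thesis
    by (elim sq_dominated_mono) (simp add: sum_nonneg)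
qed

section \<open>The gradient step as a contraction\<close>

text \<open>With a nonzero gradient, the quadratic upper bound would make a short step against it go below
  the minimum.\<close>

lemma grad_at_minimizer:
  fixes f :: "'a::real_inner \<Rightarrow> real"
  assumes smooth: "l_smooth l f" and min: "is_arg_min f (\<lambda>_. True) z"
  shows "grad f z = 0"
proof (rule ccontr)
  let ?G = "grad f z"
  assume "?G \<noteq> 0"
  have "\<bar>l\<bar> + 1 > 0" by linarith
  \<comment> \<open>Any positive \<open>s\<close> with \<open>l * s < 2\<close> decreases \<open>f\<close>; the absolute value covers every real \<open>l\<close>.\<close>
  define s where "s = 1 / (\<bar>l\<bar> + 1)"
  have s: "s > 0" "l * s < 2" using \<open>\<bar>l\<bar> + 1 > 0\<close> by (auto simp: s_def field_simps)
  have "f z \<le> f (z - s *\<^sub>R ?G)"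
    using min by (auto simp: is_arg_min_linorder)
  also have "\<dots> \<le> f z + ?G \<bullet> ((z - s *\<^sub>R ?G) - z) + l / 2 * (norm ((z - s *\<^sub>R ?G) - z))\<^sup>2"
    using smooth unfolding l_smooth_def by blast
  also have "\<dots> = f z - s * (1 - l * s / 2) * (norm ?G)\<^sup>2"
  proof -
    have eq: "(z - s *\<^sub>R ?G) - z = - (s *\<^sub>R ?G)" by simp
    have "?G \<bullet> - (s *\<^sub>R ?G) = - s * (norm ?G)\<^sup>2"
      by (simp only: power2_norm_eq_inner inner_minus_right inner_scaleR_right mult_minus_left)
    moreover have "(norm (- (s *\<^sub>R ?G)))\<^sup>2 = s * s * (norm ?G)\<^sup>2"
      by (simp only: norm_minus_cancel norm_scaleR power_mult_distrib power2_abs power2_eq_square[of s])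
    ultimately show ?thesis unfolding eq by (simp only:) (simp add: algebra_simps)
  qed
  finally have "s * (1 - l * s / 2) * (norm ?G)\<^sup>2 \<le> 0" by simp
  moreover have "s * (1 - l * s / 2) * (norm ?G)\<^sup>2 > 0"
    using s \<open>?G \<noteq> 0\<close> by (intro mult_pos_pos) auto
  ultimately show False by linarith
qed

lemma l_smooth_mono:
  assumes "l_smooth l f" "l \<le> l'"
  shows "l_smooth l' f"
proof -
  have "l / 2 * (norm (y - x))\<^sup>2 \<le> l' / 2 * (norm (y - x))\<^sup>2" for x y :: 'a
    using assms(2) by (intro mult_right_mono) auto
  moreover have "f y \<le> f x + grad f x \<bullet> (y - x) + l / 2 * (norm (y - x))\<^sup>2" for x y
    using assms(1) unfolding l_smooth_def by blast
  ultimately show ?thesis unfolding l_smooth_def by (smt (verit))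
qed

lemma strong_convexity_le_smoothness:
  fixes f :: "'a::euclidean_space \<Rightarrow> real"
  assumes "strongly_convex \<alpha> f" "l_smooth l f"
  shows "\<alpha> \<le> l"
proof -
  obtain b :: 'a where b: "b \<in> Basis" using nonempty_Basis by blast
  have "f b \<ge> f 0 + grad f 0 \<bullet> (b - 0) + \<alpha> / 2 * (norm (b - 0))\<^sup>2"
    using assms(1) unfolding strongly_convex_def by blast
  moreover have "f b \<le> f 0 + grad f 0 \<bullet> (b - 0) + l / 2 * (norm (b - 0))\<^sup>2"
    using assms(2) unfolding l_smooth_def by blast
  ultimately show ?thesis using b by simp
qed

text \<open>The lower quadratic bound at \<open>z\<close> and the upper one at \<open>x\<close> are compared at \<open>x - a\<close>, those with
  the roles of \<open>x\<close> and \<open>z\<close> exchanged at \<open>z + a\<close>. In the sum of the two comparisons the function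
  values cancel, and what remains is quadratic in \<open>a\<close>. The chosen \<open>a\<close> is its optimum, which exists
  because \<open>\<alpha> < l\<close>.\<close>

lemma gradient_cocoercive_strict:
  fixes f :: "'a::real_inner \<Rightarrow> real"
  assumes convex: "strongly_convex \<alpha> f" and smooth: "l_smooth l f"
    and crit: "grad f z = 0" and less: "\<alpha> < l"
  shows "l * \<alpha> * (norm (x - z))\<^sup>2 + (norm (grad f x))\<^sup>2 \<le> (l + \<alpha>) * (grad f x \<bullet> (x - z))"
proof -
  define G where "G = grad f x"
  define d where "d = x - z"
  define a where "a = (1 / (l - \<alpha>)) *\<^sub>R (G - \<alpha> *\<^sub>R d)"
  have lower: "f q \<ge> f p + grad f p \<bullet> (q - p) + \<alpha> / 2 * (norm (q - p))\<^sup>2" for p q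
    using convex unfolding strongly_convex_def by blast
  have upper: "f q \<le> f p + grad f p \<bullet> (q - p) + l / 2 * (norm (q - p))\<^sup>2" for p q
    using smooth unfolding l_smooth_def by blast
  have "f z + \<alpha> / 2 * (norm (d - a))\<^sup>2 \<le> f x - G \<bullet> a + l / 2 * (norm a)\<^sup>2"
    using lower[of z "x - a"] upper[of "x - a" x] crit
    by (simp add: G_def d_def algebra_simps)
  moreover have "f x + G \<bullet> (a - d) + \<alpha> / 2 * (norm (d - a))\<^sup>2 \<le> f z + l / 2 * (norm a)\<^sup>2"
  proof -
    have "z + a - x = a - d" by (simp add: d_def)
    then show ?thesis
      using lower[of x "z + a"] upper[of "z + a" z] crit norm_minus_commute[of d a]
      by (simp only: G_def) simp
  qed
  ultimately have "\<alpha> * (norm (d - a))\<^sup>2 + 2 * (G \<bullet> a) \<le> l * (norm a)\<^sup>2 + G \<bullet> d"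
    by (simp add: inner_diff_right algebra_simps)
  then have key: "\<alpha> * (d \<bullet> d) + 2 * ((G - \<alpha> *\<^sub>R d) \<bullet> a) - (l - \<alpha>) * (a \<bullet> a) \<le> G \<bullet> d"
    by (simp add: power2_norm_eq_inner inner_diff_left inner_diff_right inner_commute algebra_simps)
  let ?w = "G - \<alpha> *\<^sub>R d"
  have "?w \<bullet> a = (?w \<bullet> ?w) / (l - \<alpha>)" by (simp add: a_def)
  moreover have "(l - \<alpha>) * (a \<bullet> a) = (?w \<bullet> ?w) / (l - \<alpha>)"
    using less by (simp add: a_def)
  ultimately have "\<alpha> * (d \<bullet> d) + (?w \<bullet> ?w) / (l - \<alpha>) \<le> G \<bullet> d" using key by simp
  then have "(l - \<alpha>) * (\<alpha> * (d \<bullet> d)) + ?w \<bullet> ?w \<le> (l - \<alpha>) * (G \<bullet> d)"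
    using less by (simp add: field_simps)
  then show ?thesis
    unfolding G_def[symmetric] d_def[symmetric]
    unfolding power2_norm_eq_inner
    by (simp add: inner_diff_left inner_diff_right inner_commute algebra_simps)
qed

text \<open>The case \<open>\<alpha> = l\<close> is reached as a limit, since \<open>f\<close> is smooth with every larger constant.\<close>

lemma gradient_cocoercive:
  fixes f :: "'a::euclidean_space \<Rightarrow> real"
  assumes convex: "strongly_convex \<alpha> f" and smooth: "l_smooth l f" and crit: "grad f z = 0"
  shows "l * \<alpha> * (norm (x - z))\<^sup>2 + (norm (grad f x))\<^sup>2 \<le> (l + \<alpha>) * (grad f x \<bullet> (x - z))"
    (is "?P l \<le> ?Q l")
proof -
  have "\<alpha> \<le> l" using strong_convexity_le_smoothness[OF convex smooth] .
  have "?P (l + e) \<le> ?Q (l + e)" if "e > 0" for e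
    using that \<open>\<alpha> \<le> l\<close> by (intro gradient_cocoercive_strict convex crit l_smooth_mono[OF smooth]) auto
  then have "eventually (\<lambda>e. ?P (l + e) \<le> ?Q (l + e)) (at_right 0)"
    by (simp add: eventually_at_right_less eventually_at_filter)
  moreover have "((\<lambda>e. ?P (l + e)) \<longlongrightarrow> ?P (l + 0)) (at_right 0)"
    by (intro tendsto_intros)
  moreover have "((\<lambda>e. ?Q (l + e)) \<longlongrightarrow> ?Q (l + 0)) (at_right 0)"
    by (intro tendsto_intros)
  ultimately have "?P (l + 0) \<le> ?Q (l + 0)"
    by (intro tendsto_le[OF trivial_limit_at_right_real]) auto
  then show ?thesis by simp
qed

text \<open>Write \<open>G\<close> for the gradient, \<open>d = x - z\<close> and \<open>M = G \<bullet> d - \<alpha> * (d \<bullet> d)\<close>, which is nonnegative by strong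
  convexity. The square of the right-hand side exceeds that of the left-hand side by
  \<open>2 * \<gamma> * M - \<gamma>\<^sup>2 * (G \<bullet> G - \<alpha>\<^sup>2 * (d \<bullet> d))\<close>. Cocoercivity bounds the bracket by \<open>(l + \<alpha>) * M\<close>, and
  \<open>\<gamma> * (l + \<alpha>) \<le> 2\<close>.\<close>

lemma gradient_step_contraction:
  fixes f :: "'a::euclidean_space \<Rightarrow> real"
  assumes convex: "strongly_convex \<alpha> f" and smooth: "l_smooth l f"
    and min: "is_arg_min f (\<lambda>_. True) z"
    and \<gamma>: "0 < \<gamma>" "\<gamma> \<le> 2 / (l + \<alpha>)"
  shows "norm (x - \<gamma> *\<^sub>R grad f x - z) \<le> (1 - \<gamma> * \<alpha>) * norm (x - z)"
    and "0 \<le> 1 - \<gamma> * \<alpha>" and "1 - \<gamma> * \<alpha> < 1"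
proof -
  have \<alpha>: "\<alpha> > 0" using convex by (simp add: strongly_convex_def)
  have le: "\<alpha> \<le> l" using strong_convexity_le_smoothness[OF convex smooth] .
  have \<gamma>l: "\<gamma> * (l + \<alpha>) \<le> 2" using \<gamma> \<alpha> le by (simp add: field_simps)
  have "\<gamma> * (2 * \<alpha>) \<le> \<gamma> * (l + \<alpha>)" using \<gamma> le by (intro mult_left_mono) auto
  then show nonneg: "0 \<le> 1 - \<gamma> * \<alpha>" using \<gamma>l by linarith
  show "1 - \<gamma> * \<alpha> < 1" using \<gamma> \<alpha> by simp
  define G where "G = grad f x"
  define d where "d = x - z"
  have crit: "grad f z = 0" using smooth min by (rule grad_at_minimizer)
  have coco: "l * \<alpha> * (d \<bullet> d) + G \<bullet> G \<le> (l + \<alpha>) * (G \<bullet> d)"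
    using gradient_cocoercive[OF convex smooth crit, of x]
    by (simp add: G_def d_def power2_norm_eq_inner)
  have "f x + G \<bullet> (z - x) + \<alpha> / 2 * (norm (z - x))\<^sup>2 \<le> f z"
    and "f z + grad f z \<bullet> (x - z) + \<alpha> / 2 * (norm (x - z))\<^sup>2 \<le> f x"
    using convex unfolding strongly_convex_def G_def by blast+
  then have mono: "0 \<le> G \<bullet> d - \<alpha> * (d \<bullet> d)"
    by (simp add: crit d_def power2_norm_eq_inner inner_diff_left inner_diff_right inner_commute
        algebra_simps)
  have "\<gamma>\<^sup>2 * (G \<bullet> G - \<alpha>\<^sup>2 * (d \<bullet> d)) \<le> \<gamma>\<^sup>2 * ((l + \<alpha>) * (G \<bullet> d - \<alpha> * (d \<bullet> d)))"
    using coco by (intro mult_left_mono) (auto simp: algebra_simps power2_eq_square)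
  also have "\<dots> = (\<gamma> * (l + \<alpha>)) * (\<gamma> * (G \<bullet> d - \<alpha> * (d \<bullet> d)))"
    by (simp add: power2_eq_square)
  also have "\<dots> \<le> 2 * (\<gamma> * (G \<bullet> d - \<alpha> * (d \<bullet> d)))"
    using \<gamma>l \<gamma> mono by (intro mult_right_mono) auto
  finally have "(d - \<gamma> *\<^sub>R G) \<bullet> (d - \<gamma> *\<^sub>R G) \<le> (1 - \<gamma> * \<alpha>)\<^sup>2 * (d \<bullet> d)"
    by (simp add: inner_diff_left inner_diff_right inner_commute algebra_simps power2_eq_square)
  then have "(norm (d - \<gamma> *\<^sub>R G))\<^sup>2 \<le> ((1 - \<gamma> * \<alpha>) * norm d)\<^sup>2"
    by (simp only: power_mult_distrib power2_norm_eq_inner)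
  then have "norm (d - \<gamma> *\<^sub>R G) \<le> (1 - \<gamma> * \<alpha>) * norm d"
    by (rule power2_le_imp_le) (use nonneg in simp)
  then show "norm (x - \<gamma> *\<^sub>R grad f x - z) \<le> (1 - \<gamma> * \<alpha>) * norm (x - z)"
    by (simp add: d_def G_def algebra_simps)
qed

lemma scaled_gradient_bound:
  fixes f :: "'a::euclidean_space \<Rightarrow> real"
  assumes "strongly_convex \<alpha> f" "l_smooth l f" "is_arg_min f (\<lambda>_. True) z"
    and "0 < \<gamma>" "\<gamma> \<le> 2 / (l + \<alpha>)"
  shows "norm (\<gamma> *\<^sub>R grad f x) \<le> 2 * norm (x - z)"
proof -
  note step = gradient_step_contraction[OF assms]
  have "\<gamma> *\<^sub>R grad f x = (x - z) - (x - \<gamma> *\<^sub>R grad f x - z)" by simp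
  then have "norm (\<gamma> *\<^sub>R grad f x) \<le> norm (x - z) + norm (x - \<gamma> *\<^sub>R grad f x - z)"
    by (metis norm_triangle_ineq4)
  moreover have "(1 - \<gamma> * \<alpha>) * norm (x - z) \<le> 1 * norm (x - z)"
    using step(3) by (intro mult_right_mono) auto
  ultimately show ?thesis using step(1)[of x] by linarith
qed

section \<open>Block structure of the controllability matrix\<close>

lemma mpow_0 [simp]: "mpow M 0 = mat 1"
  by (simp add: mpow_def)

lemma mpow_Suc [simp]: "mpow M (Suc k) = M ** mpow M k"
  by (simp add: mpow_def)

lemma mpow_commute: "mpow M k ** M = M ** mpow M k"
  by (induction k) (simp_all, metis matrix_mul_assoc)

lemma blk_less: "blk (k :: 'k::{finite,linorder}) < CARD('k)"
proof -
  have "{..<k} \<subset> UNIV" by auto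
  then show ?thesis unfolding blk_def by (intro psubset_card_mono) auto
qed

lemma blk_bij: "bij_betw (blk :: 'k::{finite,linorder} \<Rightarrow> nat) UNIV {..<CARD('k)}"
proof -
  have less: "blk k < blk k'" if "k < k'" for k k' :: 'k
  proof -
    have "{..<k} \<subset> {..<k'}" using that by auto
    then show ?thesis unfolding blk_def by (intro psubset_card_mono) auto
  qed
  have inj: "inj (blk :: 'k \<Rightarrow> nat)"
    by (rule injI) (metis less less_irrefl linorder_less_linear)
  have "range (blk :: 'k \<Rightarrow> nat) \<subseteq> {..<CARD('k)}"
    using blk_less by auto
  moreover have "card (range (blk :: 'k \<Rightarrow> nat)) = CARD('k)"
    using inj by (rule card_image)
  ultimately have "range (blk :: 'k \<Rightarrow> nat) = {..<CARD('k)}"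
    by (intro card_subset_eq) auto
  with inj show ?thesis by (simp add: bij_betw_def)
qed

lemma ctrb_entry:
  "ctrb A B $ i $ p = (mpow A (blk (fst p)) ** B) $ i $ snd p"
  by (simp add: ctrb_def)

lemma ctrb_mult_entry: "(A ** ctrb A B) $ i $ q = (mpow A (Suc (blk (fst q))) ** B) $ i $ snd q"
proof -
  have "(A ** ctrb A B) $ i $ q = (A ** (mpow A (blk (fst q)) ** B)) $ i $ snd q"
    unfolding matrix_matrix_mult_def[of A] by (simp add: ctrb_entry)
  then show ?thesis by (simp add: matrix_mul_assoc)
qed

lemma ctrb_shiftW_entry:
  fixes A :: "real^'n^'n" and B :: "real^'m^'n" and q :: "'k::{finite,linorder} \<times> 'm"
  shows "((ctrb A B :: real^('k \<times> 'm)^'n) ** shiftW) $ i $ q =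
    (if Suc (blk (fst q)) < CARD('k) then (mpow A (Suc (blk (fst q))) ** B) $ i $ snd q else 0)"
proof (cases "Suc (blk (fst q)) < CARD('k)")
  case True
  then obtain k :: 'k where k: "blk k = Suc (blk (fst q))"
    using blk_bij by (metis bij_betw_imp_surj_on imageE lessThan_iff)
  have *: "blk (fst p) = Suc (blk (fst q)) \<and> snd p = snd q \<longleftrightarrow> p = (k, snd q)" for p :: "'k \<times> 'm"
    using k injD[OF bij_betw_imp_inj_on[OF blk_bij], of "fst p" k] by (auto simp: prod_eq_iff)
  show ?thesis
    using True k
    by (simp add: matrix_matrix_mult_def[of "ctrb A B"] ctrb_entry shiftW_def * if_distrib
        cong: if_cong del: mpow_Suc)
next
  case False
  then have "blk (fst p) \<noteq> blk (fst q) + 1" for p :: "'k \<times> 'm"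
    using blk_less[of "fst p"] by simp
  then have "((ctrb A B :: real^('k \<times> 'm)^'n) ** shiftW) $ i $ q = 0"
    by (simp add: matrix_matrix_mult_def[of "ctrb A B"] shiftW_def)
  with False show ?thesis by simp
qed

lemma mult_last_block_entry:
  fixes M :: "real^'m^'n" and q :: "'k::{finite,linorder} \<times> 'm"
  shows "(M ** (last_block :: real^('k \<times> 'm)^'m)) $ i $ q =
    (if Suc (blk (fst q)) = CARD('k) then M $ i $ snd q else 0)"
proof -
  have "blk (fst q) = CARD('k) - 1 \<longleftrightarrow> Suc (blk (fst q)) = CARD('k)"
    using blk_less[of "fst q"] by linarith
  then show ?thesis
    by (simp add: matrix_matrix_mult_def last_block_def if_distrib cong: if_cong)
qed

text \<open>Multiplication by \<open>A\<close> turns the block \<open>A^k B\<close> into \<open>A^(k+1) B\<close>. For the plan this means that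
  every block moves one place further, except the last one, which leaves the plan and becomes the
  input that is applied now.\<close>

lemma ctrb_shift:
  fixes A :: "real^'n^'n" and B :: "real^'m^'n"
  defines "S \<equiv> (ctrb A B :: real^('k::{finite,linorder} \<times> 'm)^'n)"
  shows "A ** S = S ** shiftW + mpow A CARD('k) ** B ** last_block"
proof -
  have "(A ** S) $ i $ q = (S ** shiftW + mpow A CARD('k) ** B ** last_block) $ i $ q" for i q
    using blk_less[of "fst q"]
    by (auto simp: S_def ctrb_mult_entry ctrb_shiftW_entry mult_last_block_entry
        vector_add_component simp del: mpow_Suc)
  then show ?thesis by (simp add: vec_eq_iff)
qed

lemma ctrb_stack:
  fixes A :: "real^'n^'n" and B :: "real^'m^'n"
  shows "(ctrb A B :: real^('k::{finite,linorder} \<times> 'm)^'n) *v stack w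
    = (\<Sum>k<CARD('k). (mpow A k ** B) *v w)"
proof -
  have "((ctrb A B :: real^('k \<times> 'm)^'n) *v stack w) $ i
      = (\<Sum>k\<in>UNIV. ((mpow A (blk (k::'k)) ** B) *v w) $ i)" for i
    by (simp add: matrix_vector_mult_def[of "ctrb A B"] matrix_vector_mult_def[of "_ ** B"]
        ctrb_entry stack_def sum.cartesian_product split_beta)
  also have "(\<Sum>k\<in>UNIV. ((mpow A (blk (k::'k)) ** B) *v w) $ i)
      = (\<Sum>k<CARD('k). (mpow A k ** B) *v w) $ i" for i
    using sum.reindex_bij_betw[OF blk_bij, of "\<lambda>k. ((mpow A k ** B) *v w) $ i"] by simp
  finally show ?thesis by (simp add: vec_eq_iff)
qed

text \<open>Each factor \<open>shiftW\<close> raises the block number by one, so \<open>i\<close> factors reach only blocks numbered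
  at least \<open>i\<close>.\<close>

lemma shiftW_power_support:
  fixes p q :: "'k::{finite,linorder} \<times> 'm::finite"
  assumes "(mpow shiftW i :: real^('k \<times> 'm)^('k \<times> 'm)) $ p $ q \<noteq> 0"
  shows "i \<le> blk (fst p)"
  using assms
proof (induction i arbitrary: p)
  case 0
  show ?case by simp
next
  case (Suc i)
  then have "(\<Sum>r\<in>UNIV. shiftW $ p $ r * (mpow shiftW i :: real^('k \<times> 'm)^('k \<times> 'm)) $ r $ q) \<noteq> 0"
    by (simp add: matrix_matrix_mult_def)
  then obtain r where r: "(shiftW :: real^('k \<times> 'm)^('k \<times> 'm)) $ p $ r \<noteq> 0"
      "(mpow shiftW i :: real^('k \<times> 'm)^('k \<times> 'm)) $ r $ q \<noteq> 0"
    by (metis (no_types, lifting) mult_eq_0_iff sum.neutral)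
  then show ?case using Suc.IH[of r] by (simp add: shiftW_def split: if_splits)
qed

lemma shiftW_nilpotent:
  "mpow (shiftW :: real^('k::{finite,linorder} \<times> 'm::finite)^('k \<times> 'm)) CARD('k) = 0"
proof -
  have "mpow (shiftW :: real^('k \<times> 'm)^('k \<times> 'm)) CARD('k) $ p $ q = 0" for p q :: "'k \<times> 'm"
    using shiftW_power_support[where i = "CARD('k)" and p = p and q = q] blk_less[of "fst p"]
    by linarith
  then show ?thesis by (simp add: vec_eq_iff)
qed

text \<open>The Gram matrix is injective: if it annihilates \<open>y\<close>, then \<open>S\<^sup>T y = 0\<close>, so \<open>y\<close> is orthogonal to the
  range of \<open>S\<close>, which is the whole space.\<close>

lemma full_row_rank_right_inverse:
  fixes S :: "real^'p^'n"
  assumes "rank S = CARD('n)"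
  shows "S ** (transpose S ** matrix_inv (S ** transpose S)) = mat 1"
proof -
  let ?Q = "S ** transpose S"
  have "inj ((*v) ?Q)"
  proof (rule injI)
    fix y z :: "real^'n"
    assume "?Q *v y = ?Q *v z"
    then have 0: "?Q *v (y - z) = 0" by (simp add: matrix_vector_mult_diff_distrib)
    let ?w = "transpose S *v (y - z)"
    have "?w \<bullet> ?w = (y - z) \<bullet> (?Q *v (y - z))"
      by (metis dot_lmul_matrix matrix_vector_mul_assoc transpose_matrix_vector)
    then have w0: "?w = 0" using 0 by simp
    obtain h where h: "S *v h = y - z"
      using assms full_rank_surjective[of S] by (metis surj_def)
    have "(y - z) \<bullet> (y - z) = ?w \<bullet> h"
      by (metis dot_lmul_matrix h transpose_matrix_vector)
    then show "y = z" using w0 by simp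
  qed
  then have "invertible ?Q"
    by (simp add: invertible_left_inverse matrix_left_invertible_injective)
  then have "?Q ** matrix_inv ?Q = mat 1"
    unfolding invertible_def matrix_inv_def by (rule someI2_ex) simp
  then show ?thesis by (simp add: matrix_mul_assoc)
qed

section \<open>The closed loop\<close>

text \<open>The corrections decided up to time \<open>t\<close> that act at time \<open>t\<close> or later. The last block acts at
  time \<open>t\<close>, the one before it at time \<open>t + 1\<close>, and so on; this is why a shift by \<open>shiftW\<close> is the passage
  of one time step.\<close>

definition plan :: "(nat \<Rightarrow> real^('k::{finite,linorder} \<times> 'm::finite)) \<Rightarrow> nat \<Rightarrow> real^('k \<times> 'm)" where
  "plan g t = (\<Sum>i<CARD('k). mpow shiftW i *v g (t - i))"

lemma plan_alt:
  fixes g :: "nat \<Rightarrow> real^('k::{finite,linorder} \<times> 'm::finite)"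
  shows "plan g t = (\<Sum>i=0..CARD('k) - 1. mpow shiftW i *v g (t - i))"
proof -
  obtain n where "CARD('k) = Suc n"
    using gr0_implies_Suc[of "CARD('k)"] by auto
  then show ?thesis by (simp add: plan_def lessThan_Suc_atMost atLeast0AtMost)
qed

lemma matrix_vector_mult_sum:
  fixes M :: "real^'a^'b"
  shows "M *v (\<Sum>i\<in>I. f i) = (\<Sum>i\<in>I. M *v f i)"
  by (rule linear_sum) (rule matrix_vector_mul_linear)

lemma shiftW_plan:
  fixes g :: "nat \<Rightarrow> real^('k::{finite,linorder} \<times> 'm::finite)"
  shows "shiftW *v plan g t = (\<Sum>i=1..CARD('k) - 1. mpow shiftW i *v g (Suc t - i))"
proof -
  obtain n where n: "CARD('k) = Suc n"
    using gr0_implies_Suc[of "CARD('k)"] by auto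
  have "shiftW *v plan g t = (\<Sum>i<Suc n. mpow shiftW (Suc i) *v g (Suc t - Suc i))"
    by (simp add: plan_def n matrix_vector_mult_sum matrix_vector_mul_assoc matrix_vector_right_distrib)
  also have "\<dots> = (\<Sum>i<n. mpow shiftW (Suc i) *v g (Suc t - Suc i))"
    using shiftW_nilpotent[where 'k = 'k and 'm = 'm] n by simp
  also have "\<dots> = (\<Sum>i=1..n. mpow shiftW i *v g (Suc t - i))"
    by (intro sum.reindex_bij_witness[of _ "\<lambda>i. i - 1" Suc]) auto
  finally show ?thesis by (simp add: n)
qed

lemma plan_Suc: "plan g (Suc t) = g (Suc t) + shiftW *v plan g t"
  for g :: "nat \<Rightarrow> real^('k::{finite,linorder} \<times> 'm::finite)"
  unfolding plan_alt[of g "Suc t"] shiftW_plan by (simp add: sum.atLeast_Suc_atMost)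

text \<open>Predictions are consistent with the dynamics. Here \<open>h\<close> is the plan at the current time and \<open>w\<close>
  the current base input. If the base input stayed at \<open>w\<close>, the state predicted \<open>\<mu>\<close> steps ahead of the
  new state would be the successor, under input \<open>w\<close>, of the state predicted \<open>\<mu>\<close> steps ahead of \<open>x\<close>.
  Replacing \<open>w\<close> by \<open>w'\<close> adds the last term.\<close>

lemma prediction_step:
  fixes A :: "real^'n^'n" and B :: "real^'m^'n"
    and h :: "real^('k::{finite,linorder} \<times> 'm)"
  defines "S \<equiv> (ctrb A B :: real^('k \<times> 'm)^'n)" and "\<mu> \<equiv> CARD('k)"
  shows "mpow A \<mu> *v (A *v x + B *v (w + last_block *v h)) + S *v stack w' + S *v (shiftW *v h)
    = A *v (mpow A \<mu> *v x + S *v stack w + S *v h) + B *v w + (S *v stack w' - S *v stack w)"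
proof -
  have shift: "A *v (S *v h) = S *v (shiftW *v h) + mpow A \<mu> *v (B *v (last_block *v h))"
    using ctrb_shift[where A = A and B = B and 'k = 'k]
    by (simp add: S_def \<mu>_def matrix_vector_mul_assoc matrix_vector_mult_add_rdistrib matrix_mul_assoc)
  have commute: "A *v (mpow A \<mu> *v x) = mpow A \<mu> *v (A *v x)"
    by (simp add: matrix_vector_mul_assoc mpow_commute)
  \<comment> \<open>Constant inputs: one more step from the zero state, split off at either end.\<close>
  have "A *v (\<Sum>k<j. (mpow A k ** B) *v w) + B *v w
      = (\<Sum>k<j. (mpow A k ** B) *v w) + mpow A j *v (B *v w)" for j
    by (induction j) (simp_all add: matrix_vector_right_distrib matrix_vector_mul_assoc matrix_mul_assoc
        algebra_simps)
  then have "A *v (S *v stack w) + B *v w = S *v stack w + mpow A \<mu> *v (B *v w)"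
    by (simp add: S_def \<mu>_def ctrb_stack)
  then show ?thesis
    using shift commute by (simp add: matrix_vector_right_distrib algebra_simps)
qed

lemma state_unrolled:
  fixes A :: "real^'n^'n" and B :: "real^'m^'n"
  assumes "\<And>t. x (Suc t) = A *v x t + B *v u (Suc t)"
  shows "x (s + n) = mpow A n *v x s + (\<Sum>k<n. (mpow A k ** B) *v u (s + n - k))"
proof (induction n)
  case 0
  show ?case by simp
next
  case (Suc n)
  have "x (s + Suc n) = A *v x (s + n) + B *v u (Suc (s + n))" using assms by simp
  also have "A *v x (s + n)
      = mpow A (Suc n) *v x s + (\<Sum>k<n. (mpow A (Suc k) ** B) *v u (s + n - k))"
    by (simp add: Suc matrix_vector_right_distrib matrix_vector_mult_sum matrix_vector_mul_assoc
        matrix_mul_assoc)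
  finally show ?case
    unfolding sum.lessThan_Suc_shift by (simp add: algebra_simps)
qed

text \<open>The closed loop in recursive form: both sums over past corrections are expressed by the plan.\<close>

lemma closed_loop_Suc:
  fixes g :: "nat \<Rightarrow> real^('k::{finite,linorder} \<times> 'm::finite)"
  assumes "closed_loop A B \<gamma>v \<gamma>x fx fu v xhat g u x"
  defines "S \<equiv> (ctrb A B :: real^('k \<times> 'm)^'n)" and "\<mu> \<equiv> CARD('k)"
  shows "g 0 = 0"
    and "v (Suc t) = v t - \<gamma>v *\<^sub>R grad (fu t) (v t)"
    and "xhat (t + \<mu>) = mpow A \<mu> *v x t + S *v stack (v (Suc t)) + S *v (shiftW *v plan g t)"
    and "g (Suc t) = - \<gamma>x *\<^sub>R ((transpose S ** matrix_inv (S ** transpose S))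
           *v grad (fx t) (xhat (t + \<mu>)))"
    and "u (Suc t) = v (Suc t) + last_block *v plan g (Suc t)"
    and "x (Suc t) = A *v x t + B *v u (Suc t)"
proof -
  note loop = assms(1)[unfolded closed_loop_def Let_def, folded S_def \<mu>_def]
  show "g 0 = 0" using loop by blast
  note loop = loop[THEN conjunct2, rule_format, of "Suc t", simplified diff_Suc_1]
  show "v (Suc t) = v t - \<gamma>v *\<^sub>R grad (fu t) (v t)"
    and "x (Suc t) = A *v x t + B *v u (Suc t)"
    using loop by simp_all
  show "xhat (t + \<mu>) = mpow A \<mu> *v x t + S *v stack (v (Suc t)) + S *v (shiftW *v plan g t)"
    using loop by (simp add: shiftW_plan \<mu>_def)
  show "g (Suc t) = - \<gamma>x *\<^sub>R ((transpose S ** matrix_inv (S ** transpose S))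
           *v grad (fx t) (xhat (t + \<mu>)))"
    using loop by (simp add: \<mu>_def)
  show "u (Suc t) = v (Suc t) + last_block *v plan g (Suc t)"
    using loop by (simp add: plan_alt \<mu>_def matrix_vector_mult_sum matrix_vector_mul_assoc)
qed

section \<open>Tracking errors\<close>

lemma norm_matrix_vector_le: "norm (M *v y) \<le> spec_norm M * norm y"
  unfolding spec_norm_def by (rule onorm) (rule matrix_vector_mul_bounded_linear)

lemma spec_norm_nonneg: "0 \<le> spec_norm M"
  unfolding spec_norm_def by (rule onorm_pos_le) (rule matrix_vector_mul_bounded_linear)

lemma gradient_tracking_dominated:
  fixes f :: "nat \<Rightarrow> 'a::euclidean_space \<Rightarrow> real"
  assumes convex: "\<And>t. strongly_convex \<alpha> (f t)" and smooth: "\<And>t. l_smooth l (f t)"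
    and min: "\<And>t. is_arg_min (f t) (\<lambda>_. True) (\<eta> t)"
    and \<gamma>: "0 < \<gamma>" "\<gamma> \<le> 2 / (l + \<alpha>)"
    and step: "\<And>t. v (Suc t) = v t - \<gamma> *\<^sub>R grad (f t) (v t)" and start: "v 0 = \<eta> 0"
    and dom: "sq_dominated D (\<lambda>t. norm (\<eta> t - \<eta> (t - 1)))"
  shows "sq_dominated D (\<lambda>t. norm (v t - \<eta> t))"
proof (rule sq_dominated_filter[OF dom])
  note contraction = gradient_step_contraction[OF convex smooth min \<gamma>]
  show "0 \<le> 1 - \<gamma> * \<alpha>" "1 - \<gamma> * \<alpha> < 1"
    using contraction(2,3) by blast+
  show "norm (v (Suc t) - \<eta> (Suc t))
      \<le> (1 - \<gamma> * \<alpha>) * norm (v t - \<eta> t) + norm (\<eta> (Suc t) - \<eta> (Suc t - 1))" for t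
    using contraction(1)[of "v t" t] norm_triangle_ineq4[of "v (Suc t) - \<eta> t" "\<eta> (Suc t) - \<eta> t"]
    by (simp add: step)
qed (simp_all add: start)

text \<open>The steady state equation makes \<open>\<theta> (t + 1)\<close> follow the same affine recursion as \<open>z (t + 1)\<close>, so the
  error after the gradient step is mapped by \<open>A\<close>, and everything else is a forcing term.\<close>

lemma prediction_error_dominated:
  fixes f :: "nat \<Rightarrow> real^'n \<Rightarrow> real" and A :: "real^'n^'n" and B K :: "real^'m^'n"
  assumes convex: "\<And>t. strongly_convex \<alpha> (f t)" and smooth: "\<And>t. l_smooth l (f t)"
    and min: "\<And>t. is_arg_min (f t) (\<lambda>_. True) (\<theta> t)"
    and \<gamma>: "0 < \<gamma>" "\<gamma> \<le> 2 / (l + \<alpha>)" and gain: "spec_norm A * (1 - \<gamma> * \<alpha>) < 1"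
    and steady: "\<And>t. \<theta> (Suc t) = A *v \<theta> (Suc t) + B *v \<eta> (Suc t)"
    and step: "\<And>t. z (Suc t) = A *v (z t - \<gamma> *\<^sub>R grad (f t) (z t)) + B *v v (Suc t)
                       + K *v (v (Suc (Suc t)) - v (Suc t))"
    and start: "z 0 = \<theta> 0"
    and \<theta>_dom: "sq_dominated D (\<lambda>t. norm (\<theta> t - \<theta> (t - 1)))"
    and v_dom: "sq_dominated D (\<lambda>t. norm (v t - \<eta> t))"
    and dv_dom: "sq_dominated D (\<lambda>t. norm (v (Suc t) - v t))"
  shows "sq_dominated D (\<lambda>t. norm (z t - \<theta> t))"
proof (rule sq_dominated_filter)
  note contraction = gradient_step_contraction[OF convex smooth min \<gamma>]
  let ?\<rho> = "spec_norm A * (1 - \<gamma> * \<alpha>)"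
  let ?b = "\<lambda>t. spec_norm A * norm (\<theta> t - \<theta> (t - 1)) + spec_norm B * norm (v t - \<eta> t)
                + spec_norm K * norm (v (Suc t) - v t)"
  show "sq_dominated D ?b"
    by (intro sq_dominated_add sq_dominated_cmult \<theta>_dom v_dom dv_dom)
  show "0 \<le> ?\<rho>" by (intro mult_nonneg_nonneg spec_norm_nonneg contraction(2))
  show "?\<rho> < 1" by (rule gain)
  show "norm (z (Suc t) - \<theta> (Suc t)) \<le> ?\<rho> * norm (z t - \<theta> t) + ?b (Suc t)" for t
  proof -
    let ?p = "z t - \<gamma> *\<^sub>R grad (f t) (z t)"
    have triangle: "norm (a - b + c + d) \<le> norm a + norm b + norm c + norm d" for a b c d :: "real^'n"
      by norm
    have "z (Suc t) - \<theta> (Suc t) = A *v (?p - \<theta> t) - A *v (\<theta> (Suc t) - \<theta> t)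
        + B *v (v (Suc t) - \<eta> (Suc t)) + K *v (v (Suc (Suc t)) - v (Suc t))"
      by (subst steady, subst step) (simp add: matrix_vector_mult_diff_distrib)
    then have "norm (z (Suc t) - \<theta> (Suc t)) \<le> norm (A *v (?p - \<theta> t))
        + norm (A *v (\<theta> (Suc t) - \<theta> t)) + norm (B *v (v (Suc t) - \<eta> (Suc t)))
        + norm (K *v (v (Suc (Suc t)) - v (Suc t)))"
      by (simp only: triangle)
    moreover have "norm (A *v (?p - \<theta> t)) \<le> ?\<rho> * norm (z t - \<theta> t)"
    proof -
      have "norm (A *v (?p - \<theta> t)) \<le> spec_norm A * norm (?p - \<theta> t)"
        by (rule norm_matrix_vector_le)
      also have "\<dots> \<le> spec_norm A * ((1 - \<gamma> * \<alpha>) * norm (z t - \<theta> t))"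
        by (intro mult_left_mono contraction(1) spec_norm_nonneg)
      finally show ?thesis by (simp add: mult.assoc)
    qed
    ultimately show ?thesis
      using norm_matrix_vector_le[of A "\<theta> (Suc t) - \<theta> t"]
        norm_matrix_vector_le[of B "v (Suc t) - \<eta> (Suc t)"]
        norm_matrix_vector_le[of K "v (Suc (Suc t)) - v (Suc t)"]
      unfolding diff_Suc_1 by linarith
  qed
qed (simp_all add: start)

lemma plan_dominated:
  fixes g :: "nat \<Rightarrow> real^('k::{finite,linorder} \<times> 'm::finite)"
  assumes dom: "sq_dominated D (\<lambda>t. norm (g t))" and D0: "D 0 = 0"
  shows "sq_dominated D (\<lambda>t. norm (plan g t))"
proof (rule sq_dominated_mono)
  show "sq_dominated D (\<lambda>t. \<Sum>i<CARD('k). spec_norm (mpow shiftW i :: real^('k \<times> 'm)^('k \<times> 'm)) * norm (g (t - i)))"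
    by (intro sq_dominated_sum sq_dominated_cmult sq_dominated_delay[OF dom D0]) simp
  show "\<bar>norm (plan g t)\<bar>
      \<le> \<bar>\<Sum>i<CARD('k). spec_norm (mpow shiftW i :: real^('k \<times> 'm)^('k \<times> 'm)) * norm (g (t - i))\<bar>" for t
    unfolding plan_def abs_norm_cancel
    by (intro order_trans[OF _ abs_ge_self] sum_norm_le norm_matrix_vector_le)
qed

text \<open>The comparison point \<open>q\<close> is arbitrary, so the estimate applies to any competing trajectory.\<close>

lemma smooth_excess_le:
  assumes "l_smooth l f" and "is_arg_min f (\<lambda>_. True) z"
  shows "f y - f q \<le> l / 2 * (norm (y - z))\<^sup>2"
proof -
  have "f z \<le> f q" using assms(2) by (auto simp: is_arg_min_linorder)
  moreover have "f y \<le> f z + grad f z \<bullet> (y - z) + l / 2 * (norm (y - z))\<^sup>2"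
    using assms(1) unfolding l_smooth_def by blast
  ultimately show ?thesis using grad_at_minimizer[OF assms] by simp
qed

theorem theorem5:
  fixes A :: "real^'n^'n" and B :: "real^'m^'n" and x0 :: "real^'n"
    and L :: "nat \<Rightarrow> real^'n \<Rightarrow> real^'m \<Rightarrow> real"
    and fx :: "nat \<Rightarrow> real^'n \<Rightarrow> real" and fu :: "nat \<Rightarrow> real^'m \<Rightarrow> real"
    and \<alpha>x lx \<alpha>u lu \<gamma>v \<gamma>x :: real
    and \<theta> :: "nat \<Rightarrow> real^'n" and \<eta> :: "nat \<Rightarrow> real^'m"
    and v u :: "nat \<Rightarrow> real^'m" and xhat x :: "nat \<Rightarrow> real^'n"
    and g :: "nat \<Rightarrow> real^('k::{finite,linorder} \<times> 'm)"
    and \<mu> :: nat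
  assumes mu: "\<mu> = CARD('k)"
    and cost: "\<And>t x u. L t x u = fx t x + fu t u"
    and fx_diff: "\<And>t. fx t differentiable_on UNIV"
    and fx_convex: "\<And>t. strongly_convex \<alpha>x (fx t)"
    and fx_smooth: "\<And>t. l_smooth lx (fx t)"
    and fu_diff: "\<And>t. fu t differentiable_on UNIV"
    and fu_convex: "\<And>t. strongly_convex \<alpha>u (fu t)"
    and fu_smooth: "\<And>t. l_smooth lu (fu t)"
    and theta: "\<And>t. is_arg_min (fx t) (\<lambda>_. True) (\<theta> t)"
    and eta: "\<And>t. is_arg_min (fu t) (\<lambda>_. True) (\<eta> t)"
    and steady: "\<And>t. t \<ge> 1 \<Longrightarrow> \<theta> t = A *v \<theta> t + B *v \<eta> t"
    and controllable: "rank (ctrb A B :: real^('k \<times> 'm)^'n) = CARD('n)"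
    and A_norm: "lx \<noteq> \<alpha>x \<Longrightarrow> spec_norm A < (lx + \<alpha>x) / (2 * (lx - \<alpha>x))"
    and alpha_u: "\<alpha>u > (2 - sqrt 2) / (2 + sqrt 2) * lu"
    and gv_pos: "\<gamma>v > 0" and gx_pos: "\<gamma>x > 0"
    and gv_lower: "(2 - sqrt 2) / (2 * \<alpha>u) < \<gamma>v"
    and gv_upper: "\<gamma>v \<le> 2 / (lu + \<alpha>u)"
    and gx_lower: "A \<noteq> 0 \<Longrightarrow> (2 * spec_norm A - 1) / (2 * spec_norm A * \<alpha>x) < \<gamma>x"
    and gx_upper: "\<gamma>x \<le> 2 / (lx + \<alpha>x)"
    and init: "x 0 = x0"
    and loop: "closed_loop A B \<gamma>v \<gamma>x fx fu v xhat g u x"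
    and eta0: "\<eta> 0 = v 0" and theta0: "\<theta> 0 = xhat \<mu>"
  shows "\<exists>\<Lambda>\<theta>>0. \<exists>\<Lambda>\<eta>>0. \<forall>T\<ge>1. \<forall>xs us. optimal_trajectory L A B x0 T xs us \<longrightarrow>
           regret L T x u xs us
             \<le> lx / 2 * (\<Sum>t=1..\<mu>-1. (norm (x t - \<theta> t))\<^sup>2)
               + \<Lambda>\<theta> * (\<Sum>t=1..T. (norm (\<theta> t - \<theta> (t - 1)))\<^sup>2)
               + \<Lambda>\<eta> * (\<Sum>t=1..T. (norm (\<eta> t - \<eta> (t - 1)))\<^sup>2)"
proof -
  define S where "S = (ctrb A B :: real^('k \<times> 'm)^'n)"
  define P where "P = transpose S ** matrix_inv (S ** transpose S)"
  define D where "D T = (\<Sum>t=1..T. (norm (\<theta> t - \<theta> (t - 1)))\<^sup>2)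
    + (\<Sum>t=1..T. (norm (\<eta> t - \<eta> (t - 1)))\<^sup>2)" for T :: nat
  define z where "z t = xhat (t + \<mu>)" for t
  define p where "p t = z t - \<gamma>x *\<^sub>R grad (fx t) (z t)" for t
  \<comment> \<open>\<open>U\<close> dominates the input error only from time \<open>1\<close> on, because \<open>u 0\<close> is arbitrary; unlike that
      error, it vanishes at time \<open>0\<close> and may be delayed.\<close>
  define U where "U t = norm (v t - \<eta> t)
    + spec_norm (last_block :: real^('k \<times> 'm)^'m) * norm (plan g t)" for t
  note dom_intros = sq_dominated_add sq_dominated_cmult sq_dominated_sum
  note loop_Suc = closed_loop_Suc[OF loop, folded S_def mu, folded P_def]
  note x_contraction = gradient_step_contraction[OF fx_convex fx_smooth theta gx_pos gx_upper]
  have \<alpha>x: "\<alpha>x > 0" using fx_convex by (simp add: strongly_convex_def)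

  have D0: "D 0 = 0" by (simp add: D_def)
  have shift_sum: "(\<Sum>t\<le>T. (norm (\<sigma> t - \<sigma> (t - 1)))\<^sup>2) = (\<Sum>t=1..T. (norm (\<sigma> t - \<sigma> (t - 1)))\<^sup>2)"
    for \<sigma> :: "nat \<Rightarrow> 'z::real_normed_vector" and T
    by (simp add: atMost_atLeast0 sum.atLeast_Suc_atMost)
  have \<theta>_dom: "sq_dominated D (\<lambda>t. norm (\<theta> t - \<theta> (t - 1)))"
    unfolding sq_dominated_def shift_sum D_def by (intro exI[of _ 1]) (simp add: sum_nonneg)
  have \<eta>_dom: "sq_dominated D (\<lambda>t. norm (\<eta> t - \<eta> (t - 1)))"
    unfolding sq_dominated_def shift_sum D_def by (intro exI[of _ 1]) (simp add: sum_nonneg)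
  have v_dom: "sq_dominated D (\<lambda>t. norm (v t - \<eta> t))"
    by (rule gradient_tracking_dominated[OF fu_convex fu_smooth eta gv_pos gv_upper loop_Suc(2)
          eta0[symmetric] \<eta>_dom])
  have dv_dom: "sq_dominated D (\<lambda>t. norm (v (Suc t) - v t))"
  proof (rule sq_dominated_mono[OF sq_dominated_cmult[OF v_dom, of 2]])
    show "\<bar>norm (v (Suc t) - v t)\<bar> \<le> \<bar>2 * norm (v t - \<eta> t)\<bar>" for t
      using scaled_gradient_bound[OF fu_convex fu_smooth eta gv_pos gv_upper, of t "v t"]
      by (simp add: loop_Suc(2))
  qed

  have Sg: "S *v g (Suc t) = - \<gamma>x *\<^sub>R grad (fx t) (z t)" for t
    using full_row_rank_right_inverse[OF controllable, folded S_def, folded P_def]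
    by (simp add: loop_Suc(4) z_def matrix_vector_mult_scaleR matrix_vector_mul_assoc
        del: scaleR_minus_left)
  have p_plan: "p t = mpow A \<mu> *v x t + S *v stack (v (Suc t)) + S *v plan g (Suc t)" for t
    using Sg[of t] loop_Suc(3)[of t]
    by (simp add: p_def z_def plan_Suc matrix_vector_right_distrib)
  define K where "K = (\<Sum>k<\<mu>. mpow A k ** B)"
  have S_stack: "S *v stack w = K *v w" for w
  proof -
    have "(\<Sum>k<j. mpow A k ** B) *v w = (\<Sum>k<j. (mpow A k ** B) *v w)" for j
      by (induction j) (simp_all add: matrix_vector_mult_add_rdistrib)
    then show ?thesis by (simp add: S_def K_def ctrb_stack mu)
  qed
  have z_step: "z (Suc t) = A *v p t + B *v v (Suc t) + K *v (v (Suc (Suc t)) - v (Suc t))" for t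
  proof -
    have "z (Suc t) = mpow A \<mu> *v (A *v x t + B *v (v (Suc t) + last_block *v plan g (Suc t)))
        + S *v stack (v (Suc (Suc t))) + S *v (shiftW *v plan g (Suc t))"
      unfolding z_def loop_Suc(3)[of "Suc t"] loop_Suc(6)[of t] loop_Suc(5)[of t] ..
    also have "\<dots> = A *v p t + B *v v (Suc t)
        + (S *v stack (v (Suc (Suc t))) - S *v stack (v (Suc t)))"
      unfolding p_plan S_def mu by (rule prediction_step)
    finally show ?thesis by (simp only: S_stack matrix_vector_mult_diff_distrib)
  qed
  \<comment> \<open>For \<open>A \<noteq> 0\<close> the lower bound on \<open>\<gamma>x\<close> rearranges to \<open>spec_norm A * (1 - \<gamma>x * \<alpha>x) < 1 / 2\<close>.\<close>
  have gain: "spec_norm A * (1 - \<gamma>x * \<alpha>x) < 1"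
  proof (cases "A = 0")
    case True
    then have "(*v) A = (\<lambda>_. 0)" by (simp add: fun_eq_iff)
    then show ?thesis by (simp add: spec_norm_def onorm_zero)
  next
    case False
    have "spec_norm A \<noteq> 0"
    proof
      assume "spec_norm A = 0"
      then have "A *v y = 0 *v y" for y using norm_matrix_vector_le[of A y] by simp
      then show False using False by (metis matrix_eq)
    qed
    then have "spec_norm A > 0" using spec_norm_nonneg[of A] by linarith
    then show ?thesis using gx_lower[OF False] \<alpha>x by (simp add: field_simps)
  qed
  have z_dom: "sq_dominated D (\<lambda>t. norm (z t - \<theta> t))"
    using z_step theta0 steady unfolding p_def
    by (intro prediction_error_dominated[OF fx_convex fx_smooth theta gx_pos gx_upper gain
          _ _ _ \<theta>_dom v_dom dv_dom, where B = B and K = K]) (auto simp: z_def)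

  have g_dom: "sq_dominated D (\<lambda>t. norm (g t))"
  proof (rule sq_dominated_mono)
    show "sq_dominated D (\<lambda>t. (spec_norm P * 2) * norm (z (t - 1) - \<theta> (t - 1)))"
      by (intro sq_dominated_cmult sq_dominated_delay[OF z_dom D0])
    show "\<bar>norm (g t)\<bar> \<le> \<bar>(spec_norm P * 2) * norm (z (t - 1) - \<theta> (t - 1))\<bar>" for t
    proof (cases t)
      case 0
      then show ?thesis by (simp add: loop_Suc(1))
    next
      case (Suc s)
      have "g (Suc s) = - (P *v (\<gamma>x *\<^sub>R grad (fx s) (z s)))"
        by (simp add: loop_Suc(4) z_def matrix_vector_mult_scaleR)
      then have "norm (g (Suc s)) \<le> spec_norm P * norm (\<gamma>x *\<^sub>R grad (fx s) (z s))"
        by (simp only: norm_minus_cancel norm_matrix_vector_le)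
      also have "\<dots> \<le> spec_norm P * (2 * norm (z s - \<theta> s))"
        by (intro mult_left_mono spec_norm_nonneg
            scaled_gradient_bound[OF fx_convex fx_smooth theta gx_pos gx_upper])
      finally show ?thesis using Suc spec_norm_nonneg[of P] by (simp add: abs_mult)
    qed
  qed
  have plan_dom: "sq_dominated D (\<lambda>t. norm (plan g t))"
    by (rule plan_dominated[OF g_dom D0])
  have U_dom: "sq_dominated D U"
    unfolding U_def by (intro dom_intros v_dom plan_dom)
  have u_le: "norm (u t - \<eta> t) \<le> U t" if pos: "t \<ge> 1" for t
  proof -
    obtain s where "t = Suc s" using pos by (cases t) auto
    then have "u t - \<eta> t = (v t - \<eta> t) + last_block *v plan g t" by (simp add: loop_Suc(5))
    then show ?thesis
      unfolding U_def
      by (simp only:) (intro order_trans[OF norm_triangle_ineq] add_left_mono norm_matrix_vector_le)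
  qed

  \<comment> \<open>The state at time \<open>t\<close> is compared with the prediction \<open>p (t - \<mu>)\<close>, which used \<open>v\<close> and the plan at time
      \<open>t - \<mu> + 1\<close>. In the sum, \<open>u (t - k) - v (t - \<mu> + 1)\<close> is split at \<open>\<eta> (t - k)\<close>, \<open>\<eta> t\<close> and
      \<open>\<eta> (t - \<mu> + 1)\<close>. That index is written \<open>t - (\<mu> - 1)\<close> so that truncation yields \<open>0\<close> at early times.\<close>
  define R where "R t = norm (z (t - \<mu>) - \<theta> (t - \<mu>)) + norm (\<theta> t - \<theta> (t - \<mu>))
    + (\<Sum>k<\<mu>. spec_norm (mpow A k ** B) * (U (t - k) + norm (\<eta> t - \<eta> (t - k))
         + norm (\<eta> t - \<eta> (t - (\<mu> - 1))) + norm (v (t - (\<mu> - 1)) - \<eta> (t - (\<mu> - 1)))))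
    + spec_norm S * norm (plan g (t - (\<mu> - 1)))" for t
  have R_dom: "sq_dominated D R"
    unfolding R_def
    by (intro dom_intros sq_dominated_delay[OF z_dom D0] sq_dominated_lag[OF \<theta>_dom D0]
        sq_dominated_delay[OF U_dom D0] sq_dominated_lag[OF \<eta>_dom D0]
        sq_dominated_delay[OF v_dom D0] sq_dominated_delay[OF plan_dom D0]) simp
  have mu_pos: "\<mu> > 0" by (simp add: mu)
  have x_le: "norm (x t - \<theta> t) \<le> R t" if "t \<ge> \<mu>" for t
  proof -
    define s where "s = t - \<mu>"
    have t: "t = s + \<mu>" and s1: "t - (\<mu> - 1) = Suc s" using that mu_pos by (auto simp: s_def)
    have triangle: "norm (a - b + c - d) \<le> norm a + norm b + norm c + norm d" for a b c d :: "real^'n"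
      by norm
    have "x t = mpow A \<mu> *v x s + (\<Sum>k<\<mu>. (mpow A k ** B) *v u (t - k))"
      unfolding t by (rule state_unrolled) (rule loop_Suc(6))
    moreover have "S *v stack (v (Suc s)) = (\<Sum>k<\<mu>. (mpow A k ** B) *v v (Suc s))"
      by (simp add: S_def ctrb_stack mu)
    ultimately have "x t - \<theta> t = (p s - \<theta> s) - (\<theta> t - \<theta> s)
        + (\<Sum>k<\<mu>. (mpow A k ** B) *v (u (t - k) - v (Suc s))) - S *v plan g (Suc s)"
      by (simp add: p_plan matrix_vector_mult_diff_distrib sum_subtractf)
    then have "norm (x t - \<theta> t) \<le> norm (p s - \<theta> s) + norm (\<theta> t - \<theta> s)
        + norm (\<Sum>k<\<mu>. (mpow A k ** B) *v (u (t - k) - v (Suc s))) + norm (S *v plan g (Suc s))"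
      by (simp only: triangle)
    moreover have "norm (p s - \<theta> s) \<le> norm (z s - \<theta> s)"
    proof -
      have "norm (p s - \<theta> s) \<le> (1 - \<gamma>x * \<alpha>x) * norm (z s - \<theta> s)"
        unfolding p_def by (rule x_contraction(1))
      also have "\<dots> \<le> 1 * norm (z s - \<theta> s)"
        using x_contraction(3) by (intro mult_right_mono) auto
      finally show ?thesis by simp
    qed
    moreover have "norm (\<Sum>k<\<mu>. (mpow A k ** B) *v (u (t - k) - v (Suc s)))
        \<le> (\<Sum>k<\<mu>. spec_norm (mpow A k ** B) * (U (t - k) + norm (\<eta> t - \<eta> (t - k))
           + norm (\<eta> t - \<eta> (Suc s)) + norm (v (Suc s) - \<eta> (Suc s))))"
    proof (rule sum_norm_le)
      fix k assume "k \<in> {..<\<mu>}"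
      then have "norm (u (t - k) - \<eta> (t - k)) \<le> U (t - k)" using that by (intro u_le) auto
      moreover have "norm (u (t - k) - v (Suc s)) \<le> norm (u (t - k) - \<eta> (t - k))
          + norm (\<eta> t - \<eta> (t - k)) + norm (\<eta> t - \<eta> (Suc s)) + norm (v (Suc s) - \<eta> (Suc s))"
        by norm
      ultimately have "norm (u (t - k) - v (Suc s)) \<le> U (t - k) + norm (\<eta> t - \<eta> (t - k))
           + norm (\<eta> t - \<eta> (Suc s)) + norm (v (Suc s) - \<eta> (Suc s))" by linarith
      then show "norm ((mpow A k ** B) *v (u (t - k) - v (Suc s)))
          \<le> spec_norm (mpow A k ** B) * (U (t - k) + norm (\<eta> t - \<eta> (t - k))
           + norm (\<eta> t - \<eta> (Suc s)) + norm (v (Suc s) - \<eta> (Suc s)))"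
        by (intro order_trans[OF norm_matrix_vector_le] mult_left_mono spec_norm_nonneg)
    qed
    ultimately show ?thesis
      using norm_matrix_vector_le[of S "plan g (Suc s)"]
      unfolding R_def s1 s_def[symmetric] by linarith
  qed

  obtain Cx where Cx: "Cx \<ge> 0" "\<And>T. (\<Sum>t\<le>T. (R t)\<^sup>2) \<le> Cx * D T"
    using R_dom unfolding sq_dominated_def by blast
  obtain Cu where Cu: "Cu \<ge> 0" "\<And>T. (\<Sum>t\<le>T. (U t)\<^sup>2) \<le> Cu * D T"
    using U_dom unfolding sq_dominated_def by blast
  have lx: "lx > 0" and lu: "lu > 0"
    using strong_convexity_le_smoothness[OF fx_convex fx_smooth]
      strong_convexity_le_smoothness[OF fu_convex fu_smooth] \<alpha>x fu_convex
    by (auto simp: strongly_convex_def intro: less_le_trans)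
  \<comment> \<open>The summand \<open>1\<close> makes the constant positive even if both dominating constants are \<open>0\<close>.\<close>
  define \<Lambda> where "\<Lambda> = lx / 2 * Cx + lu / 2 * Cu + 1"
  have "\<Lambda> > 0" using lx lu Cx(1) Cu(1) by (simp add: \<Lambda>_def add_nonneg_pos)
  have "regret L T x u xs us \<le> lx / 2 * (\<Sum>t=1..\<mu>-1. (norm (x t - \<theta> t))\<^sup>2)
      + \<Lambda> * (\<Sum>t=1..T. (norm (\<theta> t - \<theta> (t - 1)))\<^sup>2)
      + \<Lambda> * (\<Sum>t=1..T. (norm (\<eta> t - \<eta> (t - 1)))\<^sup>2)" for T xs us
  proof -
    let ?X = "\<lambda>t. (norm (x t - \<theta> t))\<^sup>2"
    have "regret L T x u xs us \<le> (\<Sum>t=1..T. lx / 2 * ?X t + lu / 2 * (norm (u t - \<eta> t))\<^sup>2)"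
      unfolding regret_def cost
    proof (rule sum_mono)
      fix t
      show "fx t (x t) + fu t (u t) - (fx t (xs t) + fu t (us t))
          \<le> lx / 2 * ?X t + lu / 2 * (norm (u t - \<eta> t))\<^sup>2"
        using smooth_excess_le[OF fx_smooth theta, of t "x t" "xs t"]
          smooth_excess_le[OF fu_smooth eta, of t "u t" "us t"] by linarith
    qed
    also have "\<dots> = lx / 2 * (\<Sum>t=1..T. ?X t) + lu / 2 * (\<Sum>t=1..T. (norm (u t - \<eta> t))\<^sup>2)"
      by (simp add: sum.distrib sum_distrib_left)
    also have "(\<Sum>t=1..T. (norm (u t - \<eta> t))\<^sup>2) \<le> Cu * D T"
    proof -
      have "(\<Sum>t=1..T. (norm (u t - \<eta> t))\<^sup>2) \<le> (\<Sum>t=1..T. (U t)\<^sup>2)"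
        by (intro sum_mono power_mono u_le) auto
      also have "\<dots> \<le> (\<Sum>t\<le>T. (U t)\<^sup>2)" by (intro sum_mono2) auto
      finally show ?thesis using Cu(2)[of T] by linarith
    qed
    also have "(\<Sum>t=1..T. ?X t) \<le> (\<Sum>t=1..\<mu>-1. ?X t) + Cx * D T"
    proof -
      have "(\<Sum>t=1..T. ?X t) \<le> (\<Sum>t\<in>{1..\<mu>-1} \<union> {\<mu>..T}. ?X t)"
        by (intro sum_mono2) auto
      also have "\<dots> = (\<Sum>t=1..\<mu>-1. ?X t) + (\<Sum>t=\<mu>..T. ?X t)"
        using mu_pos by (intro sum.union_disjoint) auto
      also have "(\<Sum>t=\<mu>..T. ?X t) \<le> (\<Sum>t=\<mu>..T. (R t)\<^sup>2)"
        by (intro sum_mono power_mono x_le) auto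
      also have "(\<Sum>t=\<mu>..T. (R t)\<^sup>2) \<le> (\<Sum>t\<le>T. (R t)\<^sup>2)" by (intro sum_mono2) auto
      also have "\<dots> \<le> Cx * D T" by (rule Cx(2))
      finally show ?thesis by simp
    qed
    finally have "regret L T x u xs us \<le> lx / 2 * (\<Sum>t=1..\<mu>-1. ?X t) + (\<Lambda> - 1) * D T"
      using lx lu by (simp add: \<Lambda>_def algebra_simps)
    moreover have "D T \<ge> 0" by (simp add: D_def sum_nonneg)
    ultimately show ?thesis by (simp add: D_def algebra_simps)
  qed
  with \<open>\<Lambda> > 0\<close> show ?thesis by blast
qed

end
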